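(* Let $M$ be a smooth manifold of dimension $n\geq 2$ and let $L=L(p,\mathbf v)$ be a smooth function on the tangent bundle $TM$ such that the Legendre map $\lambda$ of $L$ is invertible with smooth inverse, the matrix $\mu_{ij}=\frac12\,\frac{\partial^2 L}{\partial v^i\,\partial v^j}$ is positive definite at every point of $TM$, and $\sum_{i=1}^n v^i\,\frac{\partial L}{\partial v^i}>0$ whenever $\mathbf v\neq 0$. Then the modified Lagrangian dynamical system $$\dot x^i=\frac{v^i}{\Omega},\qquad \frac{d}{dt}\left(\frac{\partial L}{\partial v^i}\right)=\frac{1}{\Omega}\,\frac{\partial L}{\partial x^i},\qquad \Omega=\sum_{i=1}^n v^i\,\frac{\partial L}{\partial v^i},$$ satisfies the additional normality condition with respect to the deviation functions $\varphi=\sum_{i=1}^n\frac{\partial L}{\partial v^i}\,\tau^i$ determined by $L$. That is, for every smooth hypersurface $\sigma$ in $M$ and every choice of local coordinates $y^1,\dots,y^{n-1}$ on $\sigma$, the system of Pfaff equations $$\frac{1}{\nu}\,\frac{\partial\nu}{\partial y^i}=-\sum_{s=1}^n\frac{\nu}{\Omega}\,\frac{\partial n_s}{\partial y^i}\,\frac{\partial H}{\partial p_s}-\sum_{s=1}^n\frac{\partial H}{\partial x^s}\,\frac{\tau^s_i}{\Omega},\qquad i=1,\dots,n-1,$$ for a nonvanishing scalar function $\nu=\nu(y^1,\dots,y^{n-1})$ on $\sigma$ is compatible.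
   Context: No Riemannian metric on $M$ is assumed. Local coordinates $x^1,\dots,x^n$ on $M$ induce coordinates $(x^i,v^i)$ on $TM$ and $(x^i,p_i)$ on $T^*M$. Legendre map and Hamilton function: $\lambda:TM\to T^*M$, $\lambda(p,\mathbf v)=(p,\mathbf p)$ with $p_i=\partial L/\partial v^i$; $h=\sum_{i} v^i\,\frac{\partial L}{\partial v^i}-L$ and $H=h\circ\lambda^{-1}$, a function on $T^*M$. Under $\lambda$, the function $\Omega$ becomes the function $\Omega=\sum_{i=1}^n p_i\,\frac{\partial H}{\partial p_i}$ on $T^*M$, and the modified Lagrange equations become $\dot x^i=\frac1\Omega\frac{\partial H}{\partial p_i}$, $\dot p_i=-\frac1\Omega\frac{\partial H}{\partial x^i}$. Data in the Pfaff equations: $\sigma$ is given locally (inside a coordinate chart of $M$) by $x^s=x^s(y^1,\dots,y^{n-1})$; $\tau^s_i=\partial x^s/\partial y^i$ are the components of the coordinate tangent vectors $\boldsymbol\tau_i$ of $\sigma$; $\mathbf n=\mathbf n(y^1,\dots,y^{n-1})$ is a smooth nowhere zero normal covector field along $\sigma$, with components $n_s$, i.e. $\sum_s n_s\,\tau^s_i=0$ for all $i$ (it is unique up to a nonvanishing scalar factor). The functions $\Omega$, $\partial H/\partial p_s$, $\partial H/\partial x^s$ are evaluated at the point of $T^*M$ with coordinates $x^s=x^s(y)$ and $p_s=\nu\, n_s(y)$, where $\nu\neq 0$. Origin of the equations: one shifts $\sigma$ along trajectories of the system with initial data $x^i|_{t=0}=x^i(y)$, $p_i|_{t=0}=\nu(y)\,n_i(y)$.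 The resulting family $x^i(t,y^1,\dots,y^{n-1})$ has variation vectors $\boldsymbol\tau_j$ with components $\partial x^i/\partial y^j$ and deviation functions $\varphi_j=\sum_i \frac{\partial L}{\partial v^i}\tau^i_j=\sum_i p_i\tau^i_j$. The Pfaff equations are equivalent to $\dot\varphi_j|_{t=0}=0$ for $j=1,\dots,n-1$ (while $\varphi_j|_{t=0}=0$ holds automatically). Compatibility: writing the Pfaff system as $\partial\nu/\partial y^i=\psi_i(y,\nu)$, compatible means that the second derivatives computed by virtue of the equations are symmetric, i.e. $\frac{\partial\psi_j}{\partial y^i}+\psi_i\,\frac{\partial\psi_j}{\partial\nu}=\frac{\partial\psi_i}{\partial y^j}+\psi_j\,\frac{\partial\psi_i}{\partial\nu}$ for all $i,j$, identically in $y$ and $\nu\neq0$. Equivalently, for each $y_0$ and each $\nu_0\ne 0$ there is a local solution with $\nu(y_0)=\nu_0$. For $n=2$ there is only one equation and the condition is vacuous. *)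

theory Defs
  imports "HOL-Analysis.Analysis"
begin

subsection \<open>Smooth maps and partial derivatives\<close>

text \<open>
  Only meant for open \<open>S\<close>.  On finite-dimensional spaces continuity of all directional
  derivatives up to order \<open>k\<close> is the usual \<open>C\<^sup>k\<close> condition.
\<close>

fun Ck_on :: "nat \<Rightarrow> 'a::real_normed_vector set \<Rightarrow> ('a \<Rightarrow> 'b::real_normed_vector) \<Rightarrow> bool" where
  "Ck_on 0 S f \<longleftrightarrow> continuous_on S f"
| "Ck_on (Suc k) S f \<longleftrightarrow>
     (\<forall>x\<in>S. f differentiable at x) \<and> (\<forall>u. Ck_on k S (\<lambda>x. frechet_derivative f (at x) u))"

definition smooth_on :: "'a::real_normed_vector set \<Rightarrow> ('a \<Rightarrow> 'b::real_normed_vector) \<Rightarrow> bool" where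
  "smooth_on S f \<longleftrightarrow> (\<forall>k. Ck_on k S f)"

definition pd :: "'i \<Rightarrow> (real^'i::finite \<Rightarrow> 'b::real_normed_vector) \<Rightarrow> real^'i \<Rightarrow> 'b" where
  "pd i f y = frechet_derivative f (at y) (axis i 1)"

text \<open>
  For a function of a pair, e.g. \<open>f(x, v)\<close> or \<open>f(x, p)\<close>: the partial derivatives in the
  \<open>i\<close>-th component of the first, respectively second, argument.
\<close>

definition pd1 ::
    "'i \<Rightarrow> ((real^'i::finite) \<times> 'c::real_normed_vector \<Rightarrow> 'b::real_normed_vector)
      \<Rightarrow> (real^'i) \<times> 'c \<Rightarrow> 'b" where
  "pd1 i f z = frechet_derivative f (at z) (axis i 1, 0)"

definition pd2 ::
    "'i \<Rightarrow> ('c::real_normed_vector \<times> (real^'i::finite) \<Rightarrow> 'b::real_normed_vector)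
      \<Rightarrow> 'c \<times> (real^'i) \<Rightarrow> 'b" where
  "pd2 i f z = frechet_derivative f (at z) (0, axis i 1)"


subsection \<open>Smooth manifolds\<close>

text \<open>A chart is a domain with a coordinate map; the values of the map off the domain are
  irrelevant.\<close>

type_synonym ('m, 'n) chart = "'m set \<times> ('m \<Rightarrow> real^'n)"

abbreviation dom_of :: "('m, 'n) chart \<Rightarrow> 'm set" where "dom_of c \<equiv> fst c"
abbreviation coord :: "('m, 'n) chart \<Rightarrow> 'm \<Rightarrow> real^'n" where "coord c \<equiv> snd c"
abbreviation range_of :: "('m, 'n) chart \<Rightarrow> (real^'n) set" where "range_of c \<equiv> coord c ` dom_of c"

definition is_chart :: "'m topology \<Rightarrow> ('m, 'n::finite) chart \<Rightarrow> bool" where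
  "is_chart M c \<longleftrightarrow> openin M (dom_of c) \<and> open (range_of c) \<and>
     homeomorphic_map (subtopology M (dom_of c)) (top_of_set (range_of c)) (coord c)"

definition transition :: "('m, 'n) chart \<Rightarrow> ('m, 'n) chart \<Rightarrow> real^'n \<Rightarrow> real^'n" where
  "transition c d = coord d \<circ> inv_into (dom_of c) (coord c)"

definition compatible_charts :: "('m, 'n::finite) chart \<Rightarrow> ('m, 'n) chart \<Rightarrow> bool" where
  "compatible_charts c d \<longleftrightarrow>
     smooth_on (coord c ` (dom_of c \<inter> dom_of d)) (transition c d) \<and>
     smooth_on (coord d ` (dom_of c \<inter> dom_of d)) (transition d c)"

definition smooth_manifold :: "'m topology \<Rightarrow> ('m, 'n::finite) chart set \<Rightarrow> bool" where
  "smooth_manifold M A \<longleftrightarrow>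
     Hausdorff_space M \<and> second_countable M \<and>
     (\<forall>c\<in>A. is_chart M c) \<and> (\<Union>c\<in>A. dom_of c) = topspace M \<and>
     (\<forall>c\<in>A. \<forall>d\<in>A. compatible_charts c d) \<and>
     (\<forall>c. is_chart M c \<and> (\<forall>d\<in>A. compatible_charts c d) \<longrightarrow> c \<in> A)"


subsection \<open>Tangent and cotangent bundles\<close>

text \<open>
  A tangent vector at \<open>q\<close> is its family of components in all charts around \<open>q\<close>, transforming
  by the Jacobian matrices of the coordinate changes; a covector transforms so that its pairing
  with tangent vectors is invariant.  Components in charts not containing \<open>q\<close> are set to \<open>0\<close>,
  which makes the family unique.
\<close>

type_synonym ('m, 'n) components = "('m, 'n) chart \<Rightarrow> real^'n"

definition charts_at :: "('m, 'n) chart set \<Rightarrow> 'm \<Rightarrow> ('m, 'n) chart set" where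
  "charts_at A q = {c \<in> A. q \<in> dom_of c}"

definition tangent_space :: "('m, 'n::finite) chart set \<Rightarrow> 'm \<Rightarrow> ('m, 'n) components set" where
  "tangent_space A q =
     {w. (\<forall>c\<in>charts_at A q. \<forall>d\<in>charts_at A q.
            w d = frechet_derivative (transition c d) (at (coord c q)) (w c)) \<and>
         (\<forall>c. c \<notin> charts_at A q \<longrightarrow> w c = 0)}"

definition cotangent_space :: "('m, 'n::finite) chart set \<Rightarrow> 'm \<Rightarrow> ('m, 'n) components set" where
  "cotangent_space A q =
     {\<xi>. (\<forall>c\<in>charts_at A q. \<forall>d\<in>charts_at A q. \<forall>u.
            \<xi> d \<bullet> frechet_derivative (transition c d) (at (coord c q)) u = \<xi> c \<bullet> u) \<and>
         (\<forall>c. c \<notin> charts_at A q \<longrightarrow> \<xi> c = 0)}"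

definition tangent_bundle ::
    "'m topology \<Rightarrow> ('m, 'n::finite) chart set \<Rightarrow> ('m \<times> ('m, 'n) components) set" where
  "tangent_bundle M A = Sigma (topspace M) (tangent_space A)"

definition cotangent_bundle ::
    "'m topology \<Rightarrow> ('m, 'n::finite) chart set \<Rightarrow> ('m \<times> ('m, 'n) components) set" where
  "cotangent_bundle M A = Sigma (topspace M) (cotangent_space A)"

text \<open>
  The coordinates \<open>(x, v)\<close> on \<open>TM\<close> and \<open>(x, p)\<close> on \<open>T\<^sup>*M\<close> induced by a chart; \<open>E\<close> is one of
  the two bundles.  They range over \<open>range_of c \<times> UNIV\<close>.
\<close>

definition bundle_coord ::
    "('m, 'n) chart \<Rightarrow> 'm \<times> ('m, 'n) components \<Rightarrow> (real^'n) \<times> (real^'n)" where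
  "bundle_coord c e = (coord c (fst e), snd e c)"

definition bundle_point ::
    "('m \<times> ('m, 'n) components) set \<Rightarrow> ('m, 'n) chart
      \<Rightarrow> (real^'n) \<times> (real^'n) \<Rightarrow> 'm \<times> ('m, 'n) components" where
  "bundle_point E c = inv_into {e \<in> E. fst e \<in> dom_of c} (bundle_coord c)"


subsection \<open>Lagrange function, Legendre map, Hamilton function\<close>

definition lagr ::
    "'m topology \<Rightarrow> ('m, 'n::finite) chart set \<Rightarrow> ('m \<times> ('m, 'n) components \<Rightarrow> real)
      \<Rightarrow> ('m, 'n) chart \<Rightarrow> (real^'n) \<times> (real^'n) \<Rightarrow> real" where
  "lagr M A L c = L \<circ> bundle_point (tangent_bundle M A) c"

definition smooth_on_TM ::
    "'m topology \<Rightarrow> ('m, 'n::finite) chart set \<Rightarrow> ('m \<times> ('m, 'n) components \<Rightarrow> real) \<Rightarrow> bool" where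
  "smooth_on_TM M A L \<longleftrightarrow> (\<forall>c\<in>A. smooth_on (range_of c \<times> UNIV) (lagr M A L c))"

definition legendre ::
    "'m topology \<Rightarrow> ('m, 'n::finite) chart set \<Rightarrow> ('m \<times> ('m, 'n) components \<Rightarrow> real)
      \<Rightarrow> 'm \<times> ('m, 'n) components \<Rightarrow> 'm \<times> ('m, 'n) components" where
  "legendre M A L e =
     (fst e, \<lambda>c. if c \<in> charts_at A (fst e)
                 then \<chi> i. pd2 i (lagr M A L c) (bundle_coord c e) else 0)"

definition legendre_inv ::
    "'m topology \<Rightarrow> ('m, 'n::finite) chart set \<Rightarrow> ('m \<times> ('m, 'n) components \<Rightarrow> real)
      \<Rightarrow> 'm \<times> ('m, 'n) components \<Rightarrow> 'm \<times> ('m, 'n) components" where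
  "legendre_inv M A L = inv_into (tangent_bundle M A) (legendre M A L)"

definition legendre_inv_coord ::
    "'m topology \<Rightarrow> ('m, 'n::finite) chart set \<Rightarrow> ('m \<times> ('m, 'n) components \<Rightarrow> real)
      \<Rightarrow> ('m, 'n) chart \<Rightarrow> (real^'n) \<times> (real^'n) \<Rightarrow> (real^'n) \<times> (real^'n)" where
  "legendre_inv_coord M A L c =
     bundle_coord c \<circ> legendre_inv M A L \<circ> bundle_point (cotangent_bundle M A) c"

text \<open>The Legendre map preserves base points, so smoothness of its inverse can be tested with
  the same chart of \<open>M\<close> on both sides.\<close>

definition smoothly_invertible_legendre ::
    "'m topology \<Rightarrow> ('m, 'n::finite) chart set \<Rightarrow> ('m \<times> ('m, 'n) components \<Rightarrow> real) \<Rightarrow> bool" where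
  "smoothly_invertible_legendre M A L \<longleftrightarrow>
     bij_betw (legendre M A L) (tangent_bundle M A) (cotangent_bundle M A) \<and>
     (\<forall>c\<in>A. smooth_on (range_of c \<times> UNIV) (legendre_inv_coord M A L c))"

definition mu :: "((real^'n::finite) \<times> (real^'n) \<Rightarrow> real) \<Rightarrow> (real^'n) \<times> (real^'n) \<Rightarrow> real^'n^'n" where
  "mu l z = (\<chi> i j. 1/2 * pd2 i (pd2 j l) z)"

definition positive_definite :: "real^'n^'n::finite \<Rightarrow> bool" where
  "positive_definite B \<longleftrightarrow> transpose B = B \<and> (\<forall>u. u \<noteq> 0 \<longrightarrow> u \<bullet> (B *v u) > 0)"

definition Omega :: "((real^'n::finite) \<times> (real^'n) \<Rightarrow> real) \<Rightarrow> (real^'n) \<times> (real^'n) \<Rightarrow> real" where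
  "Omega l z = (\<Sum>i\<in>UNIV. snd z $ i * pd2 i l z)"

text \<open>Coordinate expressions on \<open>T\<^sup>*M\<close> of the Hamilton function \<open>H = h \<circ> \<lambda>\<inverse>\<close>, where
  \<open>h = \<Omega> - L\<close>, and of \<open>\<Omega> \<circ> \<lambda>\<inverse>\<close>.\<close>

definition Hamiltonian ::
    "'m topology \<Rightarrow> ('m, 'n::finite) chart set \<Rightarrow> ('m \<times> ('m, 'n) components \<Rightarrow> real)
      \<Rightarrow> ('m, 'n) chart \<Rightarrow> (real^'n) \<times> (real^'n) \<Rightarrow> real" where
  "Hamiltonian M A L c =
     (\<lambda>z. Omega (lagr M A L c) z - lagr M A L c z) \<circ> legendre_inv_coord M A L c"

definition Omega_dual ::
    "'m topology \<Rightarrow> ('m, 'n::finite) chart set \<Rightarrow> ('m \<times> ('m, 'n) components \<Rightarrow> real)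
      \<Rightarrow> ('m, 'n) chart \<Rightarrow> (real^'n) \<times> (real^'n) \<Rightarrow> real" where
  "Omega_dual M A L c = Omega (lagr M A L c) \<circ> legendre_inv_coord M A L c"


subsection \<open>Hypersurfaces\<close>

definition smooth_hypersurface :: "'m topology \<Rightarrow> ('m, 'n::finite) chart set \<Rightarrow> 'm set \<Rightarrow> bool" where
  "smooth_hypersurface M A \<sigma> \<longleftrightarrow> \<sigma> \<subseteq> topspace M \<and>
     (\<forall>q\<in>\<sigma>. \<exists>c\<in>A. q \<in> dom_of c \<and> (\<exists>k. \<sigma> \<inter> dom_of c = {r \<in> dom_of c. coord c r $ k = 0}))"

text \<open>
  Local coordinates on \<open>\<sigma>\<close> inside the chart \<open>c\<close>, given by the inverse map \<open>g\<close> from the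
  coordinate domain \<open>Y\<close> to \<open>\<sigma>\<close>.
\<close>

definition local_coordinates ::
    "'m topology \<Rightarrow> 'm set \<Rightarrow> ('m, 'n::finite) chart \<Rightarrow> (real^'k::finite) set
      \<Rightarrow> (real^'k \<Rightarrow> 'm) \<Rightarrow> bool" where
  "local_coordinates M \<sigma> c Y g \<longleftrightarrow>
     open Y \<and> g ` Y \<subseteq> dom_of c \<and> openin (subtopology M \<sigma>) (g ` Y) \<and>
     homeomorphic_map (top_of_set Y) (subtopology M (g ` Y)) g \<and>
     smooth_on Y (coord c \<circ> g) \<and>
     (\<forall>y\<in>Y. inj (frechet_derivative (coord c \<circ> g) (at y)))"

text \<open>In the following \<open>x\<close> is the coordinate expression of \<open>\<sigma>\<close>, and \<open>pd i x y $ s\<close> is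
  \<open>\<tau>\<^sup>s\<^sub>i\<close>.\<close>

definition normal_covector_field ::
    "(real^'k::finite) set \<Rightarrow> (real^'k \<Rightarrow> real^'n::finite) \<Rightarrow> (real^'k \<Rightarrow> real^'n) \<Rightarrow> bool" where
  "normal_covector_field Y x N \<longleftrightarrow> smooth_on Y N \<and>
     (\<forall>y\<in>Y. N y \<noteq> 0 \<and> (\<forall>i. (\<Sum>s\<in>UNIV. N y $ s * pd i x y $ s) = 0))"


subsection \<open>Pfaff equations\<close>

text \<open>
  The right-hand side \<open>\<psi>\<^sub>i(y, \<nu>)\<close> of the Pfaff equations solved for \<open>\<partial>\<nu>/\<partial>y\<^sup>i\<close>, with
  \<open>H\<close> and \<open>W\<close> the coordinate expressions of the Hamilton function and of \<open>\<Omega>\<close> on \<open>T\<^sup>*M\<close>.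
  They express \<open>d\<phi>\<^sub>i/dt = 0\<close> at \<open>t = 0\<close> for the deviation functions \<open>\<phi>\<^sub>i = (\<Sum>s. p\<^sub>s \<tau>\<^sup>s\<^sub>i)\<close> when
  \<open>\<sigma>\<close> is shifted along the trajectories of the modified system
  \<open>dx\<^sup>s/dt = (\<partial>H/\<partial>p\<^sub>s)/\<Omega>\<close>, \<open>dp\<^sub>s/dt = -(\<partial>H/\<partial>x\<^sup>s)/\<Omega>\<close> (the Legendre transform of the modified
  Lagrange equations) with initial momentum \<open>\<nu> n\<close>.
\<close>

definition pfaff_rhs ::
    "((real^'n::finite) \<times> (real^'n) \<Rightarrow> real) \<Rightarrow> ((real^'n) \<times> (real^'n) \<Rightarrow> real)
      \<Rightarrow> (real^'k::finite \<Rightarrow> real^'n) \<Rightarrow> (real^'k \<Rightarrow> real^'n) \<Rightarrow> 'k \<Rightarrow> (real^'k) \<times> real \<Rightarrow> real" where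
  "pfaff_rhs H W x N i = (\<lambda>(y, \<nu>).
     let z = (x y, \<nu> *\<^sub>R N y) in
     \<nu> * (- (\<Sum>s\<in>UNIV. \<nu> / W z * pd i N y $ s * pd2 s H z)
          - (\<Sum>s\<in>UNIV. pd1 s H z * (pd i x y $ s / W z))))"

text \<open>Differentiability is demanded so that the Frechet derivatives below are meaningful.\<close>

definition pfaff_compatible ::
    "(real^'k::finite) set \<Rightarrow> ('k \<Rightarrow> (real^'k) \<times> real \<Rightarrow> real) \<Rightarrow> bool" where
  "pfaff_compatible Y \<psi> \<longleftrightarrow> (\<forall>y\<in>Y. \<forall>\<nu>. \<nu> \<noteq> 0 \<longrightarrow>
     (\<forall>i. \<psi> i differentiable at (y, \<nu>)) \<and>
     (\<forall>i j. pd1 i (\<psi> j) (y, \<nu>) + \<psi> i (y, \<nu>) * frechet_derivative (\<psi> j) (at (y, \<nu>)) (0, 1)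
          = pd1 j (\<psi> i) (y, \<nu>) + \<psi> j (y, \<nu>) * frechet_derivative (\<psi> i) (at (y, \<nu>)) (0, 1)))"

end

theory Submission
  imports Defs
begin

text \<open>
  On the conormal lift of the hypersurface, \<open>h(y, \<nu>) = H(x(y), \<nu> n(y))\<close> satisfies
  \<open>\<partial>h/\<partial>\<nu> = (\<Sum>s. n\<^sub>s \<partial>H/\<partial>p\<^sub>s) = \<Omega>/\<nu>\<close>, so the Pfaff equations read
  \<open>\<partial>\<nu>/\<partial>y\<^sup>i = - (\<partial>h/\<partial>y\<^sup>i)/(\<partial>h/\<partial>\<nu>)\<close>: they say that \<open>H\<close> is constant along the lift.
  Their compatibility is then the symmetry of the second derivatives of \<open>h\<close>.  The division is
  legitimate since \<open>\<Omega> > 0\<close> for \<open>v \<noteq> 0\<close> forces \<open>\<partial>L/\<partial>v = 0\<close> at \<open>v = 0\<close>, whence \<open>p \<noteq> 0\<close> implies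
  \<open>v \<noteq> 0\<close>.
\<close>

section \<open>Symmetry of second derivatives\<close>

text \<open>The mean value theorem in direction \<open>u\<close> turns the second difference into
  \<open>t\<close> times an increment of the first derivative over the step
  \<open>t *\<^sub>R v\<close>. Differentiability of that derivative at the single point
  \<open>x\<close> evaluates the increment as \<open>t * F' v\<close> up to o(t).\<close>

lemma second_difference_quotient_tendsto:
  fixes f :: "'a::real_normed_vector \<Rightarrow> real"
  assumes S: "open S" "x \<in> S" and f: "\<And>z. z \<in> S \<Longrightarrow> f differentiable at z"
    and F: "((\<lambda>z. frechet_derivative f (at z) u) has_derivative F') (at x)"
  shows "((\<lambda>t. (f (x + t *\<^sub>R u + t *\<^sub>R v) - f (x + t *\<^sub>R u) - f (x + t *\<^sub>R v) + f x) / t\<^sup>2)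
           \<longlongrightarrow> F' v) (at_right 0)"
proof (rule tendstoI)
  fix e :: real
  assume e: "0 < e"
  define F where "F z = frechet_derivative f (at z) u" for z
  \<comment> \<open>\<open>t * K\<close> bounds every displacement from \<open>x\<close> that occurs
    for parameter \<open>t\<close>; the summand 1 keeps \<open>K\<close> positive when
    \<open>u\<close> and \<open>v\<close> both vanish.\<close>
  define K where "K = norm u + norm v + 1"
  have K: "K > 0"
    unfolding K_def by (smt (verit) norm_ge_zero)
  \<comment> \<open>The linear approximation of \<open>F\<close> is used at two points, each time
    with error at most \<open>\<epsilon> * (t * K)\<close>; after division by \<open>t\<close> the
    total is \<open>e / 2\<close>.\<close>
  define \<epsilon> where "\<epsilon> = e / (4 * K)"
  have \<epsilon>: "\<epsilon> > 0"
    using e K by (simp add: \<epsilon>_def)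
  interpret F': bounded_linear F'
    using F by (rule has_derivative_bounded_linear)
  obtain d1 where d1: "d1 > 0"
    "\<And>z. norm (z - x) < d1 \<Longrightarrow> \<bar>F z - F x - F' (z - x)\<bar> \<le> \<epsilon> * norm (z - x)"
    using F \<epsilon> unfolding has_derivative_at_alt F_def by (metis real_norm_def)
  obtain d2 where d2: "d2 > 0" "ball x d2 \<subseteq> S"
    using S open_contains_ball by blast
  \<comment> \<open>For \<open>t < d\<close> all displacements stay below \<open>d1\<close>, where
    the linear approximation of \<open>F\<close> holds, and below \<open>d2\<close>, so that no
    point leaves \<open>S\<close>.\<close>
  define d where "d = min d1 d2 / K"
  have d: "d > 0"
    using d1(1) d2(1) K by (simp add: d_def)
  show "\<forall>\<^sub>F t in at_right 0.
      dist ((f (x + t *\<^sub>R u + t *\<^sub>R v) - f (x + t *\<^sub>R u) - f (x + t *\<^sub>R v) + f x) / t\<^sup>2) (F' v) < e"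
  proof (rule eventually_at_rightI[OF _ d])
    fix t assume t: "t \<in> {0<..<d}"
    have small: "norm (s *\<^sub>R u + r *\<^sub>R v) \<le> t * K" if "0 \<le> s" "s \<le> t" "0 \<le> r" "r \<le> t" for s r
    proof -
      have "norm (s *\<^sub>R u + r *\<^sub>R v) \<le> s * norm u + r * norm v"
        using that norm_triangle_ineq[of "s *\<^sub>R u" "r *\<^sub>R v"] by simp
      also have "\<dots> \<le> t * norm u + t * norm v"
        using that by (intro add_mono mult_right_mono) auto
      also have "\<dots> \<le> t * K"
        using t by (simp add: K_def algebra_simps)
      finally show ?thesis .
    qed
    have tK: "t * K < d1" "t * K < d2"
      using t K by (auto simp: d_def pos_less_divide_eq)
    have inS: "x + s *\<^sub>R u + r *\<^sub>R v \<in> S" if "0 \<le> s" "s \<le> t" "0 \<le> r" "r \<le> t" for s r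
    proof -
      have "x + s *\<^sub>R u + r *\<^sub>R v \<in> ball x d2"
        using small[OF that] tK
        by (simp add: dist_norm norm_minus_commute add.assoc) (simp add: add.commute)
      then show ?thesis using d2 by blast
    qed
    have der: "((\<lambda>s. f (x + s *\<^sub>R u + r *\<^sub>R v)) has_real_derivative F (x + s *\<^sub>R u + r *\<^sub>R v)) (at s)"
      if "0 \<le> s" "s \<le> t" "0 \<le> r" "r \<le> t" for s r
    proof -
      have h: "(f has_derivative frechet_derivative f (at (x + s *\<^sub>R u + r *\<^sub>R v)))
              (at (x + s *\<^sub>R u + r *\<^sub>R v))"
        using f[OF inS[OF that]] by (simp add: frechet_derivative_works)
      have g: "((\<lambda>s. x + s *\<^sub>R u + r *\<^sub>R v) has_derivative (\<lambda>h. h *\<^sub>R u)) (at s)"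
        by (auto intro!: derivative_eq_intros)
      have "((\<lambda>s. f (x + s *\<^sub>R u + r *\<^sub>R v)) has_derivative
              (\<lambda>h. frechet_derivative f (at (x + s *\<^sub>R u + r *\<^sub>R v)) (h *\<^sub>R u))) (at s)"
        by (rule has_derivative_compose[OF g h])
      moreover have "frechet_derivative f (at (x + s *\<^sub>R u + r *\<^sub>R v)) (h *\<^sub>R u)
          = F (x + s *\<^sub>R u + r *\<^sub>R v) * h" for h
        unfolding F_def
        using linear_scale[OF has_derivative_linear[OF h]] by simp
      ultimately show ?thesis
        by (simp add: has_field_derivative_def mult_commute_abs)
    qed
    define g where "g s = f (x + s *\<^sub>R u + t *\<^sub>R v) - f (x + s *\<^sub>R u)" for s
    have "\<exists>\<xi>>0. \<xi> < t \<and> g t - g 0 = (t - 0) * (F (x + \<xi> *\<^sub>R u + t *\<^sub>R v) - F (x + \<xi> *\<^sub>R u))"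
    proof (rule MVT2)
      show "0 < t" using t by simp
      fix s assume s: "0 \<le> s" "s \<le> t"
      show "(g has_real_derivative F (x + s *\<^sub>R u + t *\<^sub>R v) - F (x + s *\<^sub>R u)) (at s)"
        unfolding g_def using der[OF s, of t] der[OF s, of 0] t
        by (auto intro!: derivative_eq_intros)
    qed
    then obtain \<xi> where \<xi>: "0 < \<xi>" "\<xi> < t"
      "g t - g 0 = t * (F (x + \<xi> *\<^sub>R u + t *\<^sub>R v) - F (x + \<xi> *\<^sub>R u))"
      by auto
    have est: "\<bar>F (x + \<xi> *\<^sub>R u + r *\<^sub>R v) - F x - F' (\<xi> *\<^sub>R u + r *\<^sub>R v)\<bar> \<le> \<epsilon> * (t * K)"
      if r: "0 \<le> r" "r \<le> t" for r
    proof -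
      note n = small[of \<xi> r]
      have "\<bar>F (x + \<xi> *\<^sub>R u + r *\<^sub>R v) - F x - F' (\<xi> *\<^sub>R u + r *\<^sub>R v)\<bar> \<le> \<epsilon> * norm (\<xi> *\<^sub>R u + r *\<^sub>R v)"
        using d1(2)[of "x + \<xi> *\<^sub>R u + r *\<^sub>R v"] n \<xi> r tK by (simp add: add.assoc)
      also have "\<dots> \<le> \<epsilon> * (t * K)"
        using n \<xi> r \<epsilon> by simp
      finally show ?thesis .
    qed
    \<comment> \<open>The estimates for \<open>r = t\<close> and \<open>r = 0\<close> share the same
      \<open>\<xi>\<close>, so the unknown term \<open>F' (\<xi> *\<^sub>R u)\<close> cancels in the
      difference.\<close>
    have "\<bar>F (x + \<xi> *\<^sub>R u + t *\<^sub>R v) - F (x + \<xi> *\<^sub>R u) - t * F' v\<bar> \<le> 2 * (\<epsilon> * (t * K))"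
      using est[of t] est[of 0] t by (simp add: F'.add F'.scaleR)
    also have "\<dots> = t * (e / 2)"
      using K by (simp add: \<epsilon>_def field_simps)
    finally have b: "\<bar>(F (x + \<xi> *\<^sub>R u + t *\<^sub>R v) - F (x + \<xi> *\<^sub>R u)) / t - F' v\<bar> \<le> e / 2"
      using t by (auto simp: abs_le_iff field_simps)
    have "(f (x + t *\<^sub>R u + t *\<^sub>R v) - f (x + t *\<^sub>R u) - f (x + t *\<^sub>R v) + f x) / t\<^sup>2
        = (F (x + \<xi> *\<^sub>R u + t *\<^sub>R v) - F (x + \<xi> *\<^sub>R u)) / t"
    proof -
      have "f (x + t *\<^sub>R u + t *\<^sub>R v) - f (x + t *\<^sub>R u) - f (x + t *\<^sub>R v) + f x = g t - g 0"
        by (simp add: g_def)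
      then show ?thesis
        unfolding \<xi>(3) using t by (simp add: power2_eq_square)
    qed
    then show "dist ((f (x + t *\<^sub>R u + t *\<^sub>R v) - f (x + t *\<^sub>R u) - f (x + t *\<^sub>R v) + f x) / t\<^sup>2) (F' v) < e"
      using b e by (simp add: dist_real_def)
  qed
qed

text \<open>The second difference does not change when \<open>u\<close> and \<open>v\<close> are
  exchanged, so both iterated derivatives are limits of the same quotient.\<close>

lemma second_derivative_symmetric:
  fixes f :: "'a::real_normed_vector \<Rightarrow> real"
  assumes "open S" "x \<in> S" "\<And>z. z \<in> S \<Longrightarrow> f differentiable at z"
    and F: "((\<lambda>z. frechet_derivative f (at z) u) has_derivative F') (at x)"
    and G: "((\<lambda>z. frechet_derivative f (at z) v) has_derivative G') (at x)"
  shows "F' v = G' u"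
proof (rule tendsto_unique)
  show "((\<lambda>t. (f (x + t *\<^sub>R u + t *\<^sub>R v) - f (x + t *\<^sub>R u) - f (x + t *\<^sub>R v) + f x) / t\<^sup>2)
           \<longlongrightarrow> F' v) (at_right 0)"
    using assms(1-3) F by (rule second_difference_quotient_tendsto)
  have "((\<lambda>t. (f (x + t *\<^sub>R v + t *\<^sub>R u) - f (x + t *\<^sub>R v) - f (x + t *\<^sub>R u) + f x) / t\<^sup>2)
           \<longlongrightarrow> G' u) (at_right 0)"
    using assms(1-3) G by (rule second_difference_quotient_tendsto)
  then show "((\<lambda>t. (f (x + t *\<^sub>R u + t *\<^sub>R v) - f (x + t *\<^sub>R u) - f (x + t *\<^sub>R v) + f x) / t\<^sup>2)
           \<longlongrightarrow> G' u) (at_right 0)"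
    by (simp add: algebra_simps)
qed simp

section \<open>Twice differentiable maps and their composition\<close>

text \<open>The direction \<open>u\<close> is held fixed in the second differentiation, so that only
  maps with values in \<open>'b\<close> are differentiated, never maps into a space of linear
  operators.\<close>

definition twice_differentiable_on ::
    "'a::real_normed_vector set \<Rightarrow> ('a \<Rightarrow> 'b::real_normed_vector) \<Rightarrow> bool" where
  "twice_differentiable_on S f \<longleftrightarrow> (\<forall>x\<in>S. f differentiable at x \<and>
     (\<forall>u. (\<lambda>z. frechet_derivative f (at z) u) differentiable at x))"

lemma twice_differentiable_onD:
  assumes "twice_differentiable_on S f" "x \<in> S"
  shows "f differentiable at x" "(\<lambda>z. frechet_derivative f (at z) u) differentiable at x"
  using assms by (simp_all only: twice_differentiable_on_def)

lemma smooth_on_imp_twice_differentiable_on: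
  assumes "smooth_on S f"
  shows "twice_differentiable_on S f"
proof -
  have "Ck_on (Suc (Suc 0)) S f"
    using assms unfolding smooth_on_def by blast
  then show ?thesis by (auto simp: twice_differentiable_on_def)
qed

lemma differentiable_transform_open:
  assumes "f differentiable at x" "open S" "x \<in> S" "\<And>z. z \<in> S \<Longrightarrow> f z = g z"
  shows "g differentiable at x"
  using assms unfolding differentiable_def
  by (meson has_derivative_transform_within_open)

lemma frechet_derivative_euclidean_representation:
  fixes f :: "'a::euclidean_space \<Rightarrow> 'b::real_normed_vector"
  assumes "f differentiable at x"
  shows "frechet_derivative f (at x) u = (\<Sum>b\<in>Basis. (u \<bullet> b) *\<^sub>R frechet_derivative f (at x) b)"
proof -
  have lin: "linear (frechet_derivative f (at x))"
    using assms by (rule linear_frechet_derivative)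
  have "frechet_derivative f (at x) (\<Sum>b\<in>Basis. (u \<bullet> b) *\<^sub>R b)
      = (\<Sum>b\<in>Basis. (u \<bullet> b) *\<^sub>R frechet_derivative f (at x) b)"
    by (simp only: linear_sum[OF lin] linear_scale[OF lin])
  then show ?thesis
    by (simp only: euclidean_representation)
qed

text \<open>In the chain rule the derivative of \<open>f\<close> acts on a direction that moves with
  the point, whereas the hypothesis on \<open>f\<close> concerns fixed directions. Expanding the
  moving direction in the basis of the intermediate space leaves fixed directions, with coefficients
  that depend on \<open>g\<close> alone.\<close>

lemma twice_differentiable_on_compose:
  fixes f :: "'b::euclidean_space \<Rightarrow> 'c::real_normed_vector"
    and g :: "'a::real_normed_vector \<Rightarrow> 'b"
  assumes S: "open S" and g: "twice_differentiable_on S g" and f: "twice_differentiable_on T f"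
    and sub: "g ` S \<subseteq> T"
  shows "twice_differentiable_on S (f \<circ> g)"
  unfolding twice_differentiable_on_def
proof (intro ballI conjI allI)
  fix x assume x: "x \<in> S"
  have gT: "g z \<in> T" if "z \<in> S" for z
    using sub that by blast
  have gd: "g differentiable at z" and fd: "f differentiable at (g z)" if "z \<in> S" for z
    using twice_differentiable_onD(1)[OF g that] twice_differentiable_onD(1)[OF f gT[OF that]] .
  show "(f \<circ> g) differentiable at x"
    using gd[OF x] fd[OF x] by (rule differentiable_chain_at)
  fix u
  show "(\<lambda>z. frechet_derivative (f \<circ> g) (at z) u) differentiable at x"
  proof (rule differentiable_transform_open[OF _ S x])
    fix z assume z: "z \<in> S"
    show "(\<Sum>b\<in>Basis. (frechet_derivative g (at z) u \<bullet> b) *\<^sub>R frechet_derivative f (at (g z)) b)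
        = frechet_derivative (f \<circ> g) (at z) u"
      unfolding frechet_derivative_compose[OF gd[OF z] fd[OF z]] o_apply
      by (rule frechet_derivative_euclidean_representation[OF fd[OF z], symmetric])
  next
    have 1: "(\<lambda>z. frechet_derivative g (at z) u) differentiable at x"
      by (rule twice_differentiable_onD(2)[OF g x])
    have 2: "(\<lambda>z. frechet_derivative f (at (g z)) b) differentiable at x" for b
    proof -
      have "(\<lambda>w. frechet_derivative f (at w) b) differentiable at (g x)"
        by (rule twice_differentiable_onD(2)[OF f gT[OF x]])
      from differentiable_chain_at[OF gd[OF x] this] show ?thesis by (simp add: o_def)
    qed
    show "(\<lambda>z. \<Sum>b\<in>Basis. (frechet_derivative g (at z) u \<bullet> b) *\<^sub>R frechet_derivative f (at (g z)) b)
        differentiable at x"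
      by (intro differentiable_sum differentiable_scaleR differentiable_inner finite_Basis ballI
          differentiable_const 1 2)
  qed
qed

section \<open>Compatibility from a first integral\<close>

text \<open>With indices for partial derivatives, and n standing for \<nu>, the quotient rule brings
  each side to -h_ij/h_n + (h_i h_jn + h_j h_in)/h_n^2 - h_i h_j h_nn/h_n^3, up to the order of the
  mixed derivatives.\<close>

lemma pfaff_compatible_first_integral:
  fixes Y :: "(real^'k::finite) set"
  assumes Y: "open Y" and h: "twice_differentiable_on (Y \<times> (UNIV - {0})) h"
    and nz: "\<And>w. w \<in> Y \<times> (UNIV - {0}) \<Longrightarrow> frechet_derivative h (at w) (0, 1) \<noteq> 0"
    and \<psi>: "\<And>i w. w \<in> Y \<times> (UNIV - {0}) \<Longrightarrow>
      \<psi> i w = - (frechet_derivative h (at w) (axis i 1, 0) / frechet_derivative h (at w) (0, 1))"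
  shows "pfaff_compatible Y \<psi>"
proof -
  define S where "S = Y \<times> (UNIV - {0::real})"
  define D where "D e w = frechet_derivative h (at w) e" for e w
  define D2 where "D2 e w = frechet_derivative (D e) (at w)" for e w
  have S: "open S"
    unfolding S_def using Y by (intro open_Times) auto
  note h = h[folded S_def] and nz = nz[folded S_def D_def] and \<psi> = \<psi>[folded S_def D_def]
  have hd: "h differentiable at w" if "w \<in> S" for w
    using h that by (simp add: twice_differentiable_on_def)
  have D: "(D e has_derivative D2 e w) (at w)" if "w \<in> S" for e w
    using h that unfolding D2_def D_def twice_differentiable_on_def frechet_derivative_works by blast
  have sym: "D2 e w e' = D2 e' w e" if "w \<in> S" for e e' w
    using second_derivative_symmetric[OF S that hd] D[OF that] unfolding D_def by blast
  have der: "(\<psi> i has_derivative (\<lambda>u. - ((D2 (axis i 1, 0) w u * D (0, 1) w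
      - D (axis i 1, 0) w * D2 (0, 1) w u) / (D (0, 1) w * D (0, 1) w)))) (at w)"
    if "w \<in> S" for i w
  proof (rule has_derivative_transform_within_open[OF _ S that])
    show "((\<lambda>w. - (D (axis i 1, 0) w / D (0, 1) w)) has_derivative
      (\<lambda>u. - ((D2 (axis i 1, 0) w u * D (0, 1) w
      - D (axis i 1, 0) w * D2 (0, 1) w u) / (D (0, 1) w * D (0, 1) w)))) (at w)"
      using nz[OF that]
      by (intro has_derivative_minus has_derivative_divide' D[OF that])
  qed (simp add: \<psi>)
  have fd: "frechet_derivative (\<psi> i) (at w) = (\<lambda>u. - ((D2 (axis i 1, 0) w u * D (0, 1) w
      - D (axis i 1, 0) w * D2 (0, 1) w u) / (D (0, 1) w * D (0, 1) w)))"
    if "w \<in> S" for i w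
    using frechet_derivative_at[OF der[OF that]] by simp
  show ?thesis
    unfolding pfaff_compatible_def
  proof (intro ballI allI impI conjI)
    fix y and \<nu> :: real assume "y \<in> Y" "\<nu> \<noteq> 0"
    then have w: "(y, \<nu>) \<in> S" by (simp add: S_def)
    fix i j
    show "\<psi> i differentiable at (y, \<nu>)"
      using der[OF w] by (auto simp: differentiable_def)
    \<comment> \<open>These are the only mixed second derivatives that occur; once each is written
      in one order, the rest is algebra with the nonzero denominator.\<close>
    note s = sym[OF w, of "(axis j 1, 0)" "(axis i 1, 0)"]
      sym[OF w, of "(0, 1)" "(axis i 1, 0)"] sym[OF w, of "(0, 1)" "(axis j 1, 0)"]
    show "pd1 i (\<psi> j) (y, \<nu>) + \<psi> i (y, \<nu>) * frechet_derivative (\<psi> j) (at (y, \<nu>)) (0, 1)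
        = pd1 j (\<psi> i) (y, \<nu>) + \<psi> j (y, \<nu>) * frechet_derivative (\<psi> i) (at (y, \<nu>)) (0, 1)"
      unfolding pd1_def fd[OF w] \<psi>[OF w] s using nz[OF w] by (simp add: field_simps)
  qed
qed

section \<open>Sums of partial derivatives as directional derivatives\<close>

text \<open>Together with \<open>sum_pd2\<close>, this rewrites the sums over \<open>s\<close> in
  the Pfaff equations so that the chain rule applies without coordinates.\<close>

lemma sum_pd1:
  fixes f :: "(real^'i::finite) \<times> 'c::real_normed_vector \<Rightarrow> real"
  assumes "f differentiable at z"
  shows "(\<Sum>s\<in>UNIV. pd1 s f z * a $ s) = frechet_derivative f (at z) (a, 0)"
proof -
  have lin: "linear (\<lambda>a. frechet_derivative f (at z) (a, 0))"
    using linear_compose[OF _ linear_frechet_derivative[OF assms], of "\<lambda>a. (a, 0)"]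
    by (simp add: o_def linear_iff)
  have "a = (\<Sum>s\<in>UNIV. a $ s *\<^sub>R axis s 1)"
    using basis_expansion[of a] by (simp add: scalar_mult_eq_scaleR)
  then have "frechet_derivative f (at z) (a, 0)
      = frechet_derivative f (at z) (\<Sum>s\<in>UNIV. a $ s *\<^sub>R axis s 1, 0)"
    by simp
  also have "\<dots> = (\<Sum>s\<in>UNIV. pd1 s f z * a $ s)"
    by (simp add: linear_sum[OF lin] linear_scale[OF lin] pd1_def mult.commute)
  finally show ?thesis by simp
qed

lemma sum_pd2:
  fixes f :: "'c::real_normed_vector \<times> (real^'i::finite) \<Rightarrow> real"
  assumes "f differentiable at z"
  shows "(\<Sum>s\<in>UNIV. b $ s * pd2 s f z) = frechet_derivative f (at z) (0, b)"
proof -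
  have lin: "linear (\<lambda>b. frechet_derivative f (at z) (0, b))"
    using linear_compose[OF _ linear_frechet_derivative[OF assms], of "\<lambda>b. (0, b)"]
    by (simp add: o_def linear_iff)
  have "b = (\<Sum>s\<in>UNIV. b $ s *\<^sub>R axis s 1)"
    using basis_expansion[of b] by (simp add: scalar_mult_eq_scaleR)
  then have "frechet_derivative f (at z) (0, b)
      = frechet_derivative f (at z) (0, \<Sum>s\<in>UNIV. b $ s *\<^sub>R axis s 1)"
    by simp
  also have "\<dots> = (\<Sum>s\<in>UNIV. b $ s * pd2 s f z)"
    by (simp add: linear_sum[OF lin] linear_scale[OF lin] pd2_def)
  finally show ?thesis by simp
qed

section \<open>The Legendre transform in one chart\<close>

text \<open>Here \<open>U\<close> is the range of a chart, \<open>l\<close> the Lagrange function in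
  coordinates (x, v), and \<open>\<Lambda>\<close> the inverse Legendre map from (x, p) to (x, v).
  The last two assumptions say that \<open>\<Lambda>\<close> followed by the Legendre map is the
  identity on \<open>U \<times> UNIV\<close>.\<close>

locale legendre_transform =
  fixes U :: "(real^'n::finite) set" and l :: "(real^'n) \<times> (real^'n) \<Rightarrow> real"
    and \<Lambda> :: "(real^'n) \<times> (real^'n) \<Rightarrow> (real^'n) \<times> (real^'n)"
  assumes U: "open U" and l: "twice_differentiable_on (U \<times> UNIV) l"
    and \<Lambda>: "\<And>z. z \<in> U \<times> UNIV \<Longrightarrow> \<Lambda> differentiable at z"
    and fst_\<Lambda>: "\<And>z. z \<in> U \<times> UNIV \<Longrightarrow> fst (\<Lambda> z) = fst z"
    and momentum: "\<And>z i. z \<in> U \<times> UNIV \<Longrightarrow> pd2 i l (\<Lambda> z) = snd z $ i"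
begin

definition H where "H z = Omega l (\<Lambda> z) - l (\<Lambda> z)"

lemma open_phase: "open (U \<times> (UNIV :: (real^'n) set))"
  using U by (simp add: open_Times)

lemma \<Lambda>_in: "z \<in> U \<times> UNIV \<Longrightarrow> \<Lambda> z \<in> U \<times> UNIV"
  using fst_\<Lambda>[of z] by (cases "\<Lambda> z") auto

lemma l_differentiable: "z \<in> U \<times> UNIV \<Longrightarrow> l differentiable at z"
  using l by (auto simp: twice_differentiable_on_def)

lemma Omega_\<Lambda>: "z \<in> U \<times> UNIV \<Longrightarrow> Omega l (\<Lambda> z) = snd (\<Lambda> z) \<bullet> snd z"
  by (simp add: Omega_def momentum inner_vec_def)

text \<open>These are Hamilton's formulas: the p-gradient of \<open>H\<close> is v and its
  x-gradient is minus that of \<open>l\<close>. Since \<open>H\<close> is the pairing of v and p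
  minus \<open>l\<close>, the variation of v enters with coefficient p minus the v-gradient of
  \<open>l\<close>, which is zero by \<open>momentum\<close>.\<close>

lemma H_has_derivative:
  assumes z: "z \<in> U \<times> UNIV"
  shows "(H has_derivative
     (\<lambda>u. snd (\<Lambda> z) \<bullet> snd u - frechet_derivative l (at (\<Lambda> z)) (fst u, 0))) (at z)"
proof -
  define D where "D = frechet_derivative \<Lambda> (at z)"
  define Dl where "Dl = frechet_derivative l (at (\<Lambda> z))"
  have D: "(\<Lambda> has_derivative D) (at z)"
    using \<Lambda>[OF z] by (simp add: D_def frechet_derivative_works)
  have Dl: "(l has_derivative Dl) (at (\<Lambda> z))"
    using l_differentiable[OF \<Lambda>_in[OF z]] by (simp add: Dl_def frechet_derivative_works)
  \<comment> \<open>\<open>\<Lambda>\<close> fixes base points on an open set, so its derivative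
    leaves the first component unchanged.\<close>
  have "((\<lambda>z. fst (\<Lambda> z)) has_derivative fst) (at z)"
    by (rule has_derivative_transform_within_open[OF has_derivative_fst[OF has_derivative_ident] open_phase z])
      (simp add: fst_\<Lambda>)
  with has_derivative_fst[OF D] have "(\<lambda>u. fst (D u)) = fst"
    by (rule has_derivative_unique)
  then have fstD: "fst (D u) = fst u" for u by metis
  have DlD: "Dl (D u) = Dl (fst u, 0) + snd (D u) \<bullet> snd z" for u
  proof -
    have "Dl (D u) = Dl ((fst u, 0) + (0, snd (D u)))"
      using fstD[of u] by (metis add_Pair add.left_neutral add.right_neutral prod.collapse)
    also have "\<dots> = Dl (fst u, 0) + Dl (0, snd (D u))"
      by (rule linear_add[OF has_derivative_linear[OF Dl]])
    also have "Dl (0, snd (D u)) = (\<Sum>s\<in>UNIV. snd (D u) $ s * pd2 s l (\<Lambda> z))"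
      unfolding Dl_def by (rule sum_pd2[symmetric]) (rule l_differentiable[OF \<Lambda>_in[OF z]])
    finally show ?thesis
      by (simp add: momentum[OF z] inner_vec_def)
  qed
  have 1: "((\<lambda>z. l (\<Lambda> z)) has_derivative (\<lambda>u. Dl (D u))) (at z)"
    by (rule has_derivative_compose[OF D Dl])
  have 2: "((\<lambda>z. snd (\<Lambda> z) \<bullet> snd z - l (\<Lambda> z)) has_derivative
      (\<lambda>u. (snd (\<Lambda> z) \<bullet> snd u + snd (D u) \<bullet> snd z) - Dl (D u))) (at z)"
    by (intro has_derivative_diff has_derivative_inner has_derivative_snd D has_derivative_ident 1)
  have "(H has_derivative (\<lambda>u. (snd (\<Lambda> z) \<bullet> snd u + snd (D u) \<bullet> snd z) - Dl (D u))) (at z)"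
    by (rule has_derivative_transform_within_open[OF 2 open_phase z]) (simp add: H_def Omega_\<Lambda>)
  then show ?thesis
    by (simp add: DlD flip: Dl_def)
qed

lemmas frechet_derivative_H = frechet_derivative_at[OF H_has_derivative, symmetric]

text \<open>The first derivative of \<open>H\<close> contains \<open>\<Lambda>\<close> and first
  derivatives of \<open>l\<close> at \<open>\<Lambda> z\<close>, but no derivative of
  \<open>\<Lambda>\<close>. It can therefore be differentiated once more.\<close>

lemma H_twice_differentiable: "twice_differentiable_on (U \<times> UNIV) H"
  unfolding twice_differentiable_on_def
proof (intro ballI conjI allI)
  fix z assume z: "z \<in> U \<times> (UNIV :: (real^'n) set)"
  show "H differentiable at z"
    using H_has_derivative[OF z] by (auto simp: differentiable_def)
  fix u :: "(real^'n) \<times> (real^'n)"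
  have "(\<lambda>z. snd (\<Lambda> z)) differentiable at z"
    using has_derivative_snd \<Lambda>[OF z] unfolding differentiable_def by blast
  moreover have "(\<lambda>z. frechet_derivative l (at (\<Lambda> z)) (fst u, 0)) differentiable at z"
  proof -
    have "(\<lambda>w. frechet_derivative l (at w) (fst u, 0)) differentiable at (\<Lambda> z)"
      by (rule twice_differentiable_onD(2)[OF l \<Lambda>_in[OF z]])
    from differentiable_chain_at[OF \<Lambda>[OF z] this] show ?thesis by (simp add: o_def)
  qed
  ultimately have "(\<lambda>z. snd (\<Lambda> z) \<bullet> snd u - frechet_derivative l (at (\<Lambda> z)) (fst u, 0))
      differentiable at z"
    by (intro differentiable_diff differentiable_inner differentiable_const)
  then show "(\<lambda>z. frechet_derivative H (at z) u) differentiable at z"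
    by (rule differentiable_transform_open[OF _ open_phase z]) (simp only: frechet_derivative_H)
qed

end

text \<open>Along each coordinate axis, \<open>\<Omega>(x, r e\<^sub>i) = r \<partial>\<^sub>i l(x, r e\<^sub>i)\<close> forces
  \<open>\<partial>\<^sub>i l(x, r e\<^sub>i)\<close> to change sign at \<open>r = 0\<close>.\<close>

lemma momentum_zero_at_zero_velocity:
  fixes l :: "(real^'n::finite) \<times> (real^'n) \<Rightarrow> real"
  assumes l: "(\<lambda>z. pd2 i l z) differentiable at (x, 0)"
    and pos: "\<And>v. v \<noteq> 0 \<Longrightarrow> Omega l (x, v) > 0"
  shows "pd2 i l (x, 0) = 0"
proof -
  define k where "k r = pd2 i l (x, axis i r)" for r
  define a :: "real^'n" where "a = axis i 1"
  have ax: "axis i r = r *\<^sub>R a" for r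
    by (simp add: a_def axis_def vec_eq_iff)
  have "isCont (\<lambda>r. (x, axis i r) :: (real^'n) \<times> (real^'n)) 0"
    unfolding ax by (intro continuous_intros)
  moreover have "isCont (\<lambda>z. pd2 i l z) (x, axis i 0)"
    using differentiable_imp_continuous_within[OF l] by (simp add: ax)
  ultimately have "isCont k 0"
    unfolding k_def by (rule isCont_o2)
  then have lim: "(k \<longlongrightarrow> k 0) (at 0)" by (simp add: isCont_def)
  have rk: "r * k r > 0" if "r \<noteq> 0" for r
  proof -
    have "axis i r \<noteq> 0"
      using that by (simp add: axis_eq_0_iff)
    then have "Omega l (x, axis i r) > 0" by (rule pos)
    moreover have "Omega l (x, axis i r) = r * k r"
      unfolding Omega_def k_def
      by (simp add: axis_def if_distrib[of "\<lambda>a. a * _"] cong: if_cong)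
    ultimately show ?thesis by simp
  qed
  have sgn: "0 < r \<Longrightarrow> 0 \<le> k r" "r < 0 \<Longrightarrow> k r \<le> 0" for r
    using rk[of r] by (auto simp: zero_less_mult_iff)
  have "0 \<le> k 0"
  proof (rule tendsto_lowerbound)
    show "(k \<longlongrightarrow> k 0) (at_right 0)" using lim by (rule tendsto_within_subset) simp
    show "\<forall>\<^sub>F r in at_right 0. 0 \<le> k r"
      unfolding eventually_at_filter
      by (rule always_eventually) (simp add: sgn)
  qed simp
  moreover have "k 0 \<le> 0"
  proof (rule tendsto_upperbound)
    show "(k \<longlongrightarrow> k 0) (at_left 0)" using lim by (rule tendsto_within_subset) simp
    show "\<forall>\<^sub>F r in at_left 0. k r \<le> 0"
      unfolding eventually_at_filter
      by (rule always_eventually) (simp add: sgn)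
  qed simp
  ultimately show ?thesis by (simp add: k_def ax)
qed

section \<open>The conormal lift of the hypersurface\<close>

text \<open>The lift sends (y, \<nu>) to the initial position and momentum of the trajectory that
  starts at the point \<open>x y\<close> of the hypersurface.\<close>

lemma conormal_lift_has_derivative:
  fixes x N :: "real^'k::finite \<Rightarrow> real^'n::finite"
  assumes "x differentiable at (fst w)" "N differentiable at (fst w)"
  shows "((\<lambda>w. (x (fst w), snd w *\<^sub>R N (fst w))) has_derivative
     (\<lambda>u. (frechet_derivative x (at (fst w)) (fst u),
        snd w *\<^sub>R frechet_derivative N (at (fst w)) (fst u) + snd u *\<^sub>R N (fst w)))) (at w)"
  using assms unfolding frechet_derivative_works
  by (intro has_derivative_Pair has_derivative_scaleR has_derivative_snd has_derivative_ident
      has_derivative_compose[OF has_derivative_fst[OF has_derivative_ident]])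

lemma conormal_lift_twice_differentiable:
  fixes x N :: "real^'k::finite \<Rightarrow> real^'n::finite"
  assumes Y: "open Y" and x: "twice_differentiable_on Y x" and N: "twice_differentiable_on Y N"
  shows "twice_differentiable_on (Y \<times> (UNIV - {0})) (\<lambda>w. (x (fst w), snd w *\<^sub>R N (fst w)))"
    (is "twice_differentiable_on ?S ?\<zeta>")
  unfolding twice_differentiable_on_def
proof (intro ballI conjI allI)
  have S: "open ?S" using Y by (intro open_Times) auto
  have der: "(?\<zeta> has_derivative (\<lambda>u. (frechet_derivative x (at (fst w)) (fst u),
        snd w *\<^sub>R frechet_derivative N (at (fst w)) (fst u) + snd u *\<^sub>R N (fst w)))) (at w)"
    if "w \<in> ?S" for w
    using x N that by (intro conormal_lift_has_derivative) (auto simp: twice_differentiable_on_def)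
  fix w assume w: "w \<in> ?S"
  show "?\<zeta> differentiable at w"
    using der[OF w] by (auto simp: differentiable_def)
  fix u :: "(real^'k) \<times> real"
  have d: "(\<lambda>w. F (fst w)) differentiable at w" if "F differentiable at (fst w)"
    for F :: "real^'k \<Rightarrow> real^'n"
    using differentiable_chain_at[of fst w F] that
    by (simp add: o_def bounded_linear_imp_differentiable bounded_linear_fst)
  have s: "snd differentiable at w"
    by (simp add: bounded_linear_imp_differentiable bounded_linear_snd)
  have y: "fst w \<in> Y" using w by auto
  show "(\<lambda>w. frechet_derivative ?\<zeta> (at w) u) differentiable at w"
  proof (rule differentiable_transform_open[OF _ S w])
    show "(\<lambda>w. (frechet_derivative x (at (fst w)) (fst u),
        snd w *\<^sub>R frechet_derivative N (at (fst w)) (fst u) + snd u *\<^sub>R N (fst w))) differentiable at w"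
      using x N y unfolding twice_differentiable_on_def
      by (intro differentiable_Pair differentiable_add differentiable_scaleR s differentiable_const
          d[of N] d[of "\<lambda>y. frechet_derivative _ (at y) (fst u)"]) auto
  qed (simp add: frechet_derivative_at[OF der, symmetric])
qed

text \<open>The first integral is \<open>H \<circ> \<zeta>\<close>, with \<open>\<zeta>\<close> the
  conormal lift. It remains to see that its \<nu>-derivative does not vanish and that the quotient
  of its derivatives reproduces \<open>pfaff_rhs\<close>.\<close>

lemma (in legendre_transform) pfaff_compatible_rhs:
  fixes Y :: "(real^'k::finite) set"
  assumes pos: "\<And>x v. x \<in> U \<Longrightarrow> v \<noteq> 0 \<Longrightarrow> Omega l (x, v) > 0"
    and Y: "open Y" and x: "twice_differentiable_on Y x" and N: "twice_differentiable_on Y N"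
    and sub: "x ` Y \<subseteq> U" and N0: "\<And>y. y \<in> Y \<Longrightarrow> N y \<noteq> 0"
  shows "pfaff_compatible Y (pfaff_rhs H (Omega l \<circ> \<Lambda>) x N)"
proof (rule pfaff_compatible_first_integral[OF Y])
  define \<zeta> where "\<zeta> w = (x (fst w), snd w *\<^sub>R N (fst w))" for w
  let ?S = "Y \<times> (UNIV - {0 :: real})"
  have \<zeta>_in: "\<zeta> w \<in> U \<times> UNIV" if "w \<in> ?S" for w
    using sub that by (auto simp: \<zeta>_def)
  have \<zeta>: "twice_differentiable_on ?S \<zeta>"
    unfolding \<zeta>_def by (rule conormal_lift_twice_differentiable[OF Y x N])
  show "twice_differentiable_on ?S (H \<circ> \<zeta>)"
  proof (rule twice_differentiable_on_compose[OF _ \<zeta> H_twice_differentiable])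
    show "open ?S" using Y by (intro open_Times) auto
    show "\<zeta> ` ?S \<subseteq> U \<times> UNIV" using \<zeta>_in by (rule image_subsetI)
  qed
  have Hd: "H differentiable at (\<zeta> w)" if "w \<in> ?S" for w
    by (rule twice_differentiable_onD(1)[OF H_twice_differentiable \<zeta>_in[OF that]])
  have h: "frechet_derivative (H \<circ> \<zeta>) (at w) u = frechet_derivative H (at (\<zeta> w))
      (frechet_derivative x (at (fst w)) (fst u),
        snd w *\<^sub>R frechet_derivative N (at (fst w)) (fst u) + snd u *\<^sub>R N (fst w))"
    if w: "w \<in> ?S" for w u
  proof -
    have y: "fst w \<in> Y" using w by auto
    have "(\<zeta> has_derivative (\<lambda>u. (frechet_derivative x (at (fst w)) (fst u),
        snd w *\<^sub>R frechet_derivative N (at (fst w)) (fst u) + snd u *\<^sub>R N (fst w)))) (at w)"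
      unfolding \<zeta>_def
      by (rule conormal_lift_has_derivative[OF twice_differentiable_onD(1)[OF x y] twice_differentiable_onD(1)[OF N y]])
    note \<zeta>' = frechet_derivative_at[OF this, symmetric]
    show ?thesis
      unfolding frechet_derivative_compose[OF twice_differentiable_onD(1)[OF \<zeta> w] Hd[OF w]]
      by (simp add: \<zeta>')
  qed
  have lin: "linear (frechet_derivative N (at y))" "linear (frechet_derivative x (at y))" if "y \<in> Y" for y
    using twice_differentiable_onD(1)[OF N that] twice_differentiable_onD(1)[OF x that]
    by (simp_all add: linear_frechet_derivative)
  have W: "Omega l (\<Lambda> (\<zeta> w)) > 0"
    and hnu: "frechet_derivative (H \<circ> \<zeta>) (at w) (0, 1) = Omega l (\<Lambda> (\<zeta> w)) / snd w"
    if w: "w \<in> ?S" for w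
  proof -
    have y: "fst w \<in> Y" and nu: "snd w \<noteq> 0" using w by auto
    have p: "snd (\<zeta> w) \<noteq> 0" using N0[OF y] nu by (simp add: \<zeta>_def)
    have xU: "fst (\<zeta> w) \<in> U" using \<zeta>_in[OF w] by auto
    have \<Lambda>\<zeta>: "\<Lambda> (\<zeta> w) = (fst (\<zeta> w), snd (\<Lambda> (\<zeta> w)))"
      using fst_\<Lambda>[OF \<zeta>_in[OF w]] by (simp add: prod_eq_iff)
    \<comment> \<open>Zero velocity would have zero momentum, but the momentum here is a nonzero
      multiple of the nonzero covector \<open>N (fst w)\<close>.\<close>
    have "snd (\<Lambda> (\<zeta> w)) \<noteq> 0"
    proof
      assume "snd (\<Lambda> (\<zeta> w)) = 0"
      then have \<Lambda>0: "\<Lambda> (\<zeta> w) = (fst (\<zeta> w), 0)" using \<Lambda>\<zeta> by simp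
      have "(\<lambda>z. pd2 i l z) differentiable at (fst (\<zeta> w), 0)" for i
        unfolding pd2_def using xU by (intro twice_differentiable_onD(2)[OF l]) simp
      from momentum_zero_at_zero_velocity[OF this pos[OF xU]]
      have "snd (\<zeta> w) = 0"
        using momentum[OF \<zeta>_in[OF w]] by (simp add: vec_eq_iff \<Lambda>0)
      with p show False by simp
    qed
    with pos[OF xU] show "Omega l (\<Lambda> (\<zeta> w)) > 0"
      using \<Lambda>\<zeta> by metis
    \<comment> \<open>Changing \<nu> alone moves the momentum along \<open>N\<close>, so by
      Hamilton's formulas the derivative is the pairing of v with \<open>N\<close>. As p is \<nu>
      times \<open>N\<close>, this is the pairing of v with p divided by \<nu>.\<close>
    have "frechet_derivative (H \<circ> \<zeta>) (at w) (0, 1) = frechet_derivative H (at (\<zeta> w)) (0, N (fst w))"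
      using lin[OF y] by (simp add: h[OF w] linear_0)
    also have "\<dots> = snd (\<Lambda> (\<zeta> w)) \<bullet> N (fst w)"
      using linear_0[OF linear_frechet_derivative[OF l_differentiable[OF \<Lambda>_in[OF \<zeta>_in[OF w]]]]]
      by (simp add: frechet_derivative_H[OF \<zeta>_in[OF w]] zero_prod_def)
    also have "\<dots> = Omega l (\<Lambda> (\<zeta> w)) / snd w"
    proof -
      have "snd (\<zeta> w) = snd w *\<^sub>R N (fst w)" by (simp add: \<zeta>_def)
      with nu show ?thesis unfolding Omega_\<Lambda>[OF \<zeta>_in[OF w]] by simp
    qed
    finally show "frechet_derivative (H \<circ> \<zeta>) (at w) (0, 1) = Omega l (\<Lambda> (\<zeta> w)) / snd w" .
  qed
  fix w assume w: "w \<in> ?S"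
  then have nu: "snd w \<noteq> 0" by auto
  show "frechet_derivative (H \<circ> \<zeta>) (at w) (0, 1) \<noteq> 0"
    using W[OF w] nu by (simp add: hnu[OF w])
  fix i
  obtain y \<nu> where wy: "w = (y, \<nu>)" by (cases w)
  define \<Omega> where "\<Omega> = Omega l (\<Lambda> (\<zeta> w))"
  define DH where "DH = frechet_derivative H (at (\<zeta> w))"
  have DHlin: "linear DH" unfolding DH_def by (rule linear_frechet_derivative[OF Hd[OF w]])
  have "(\<Sum>s\<in>UNIV. \<nu> / \<Omega> * pd i N y $ s * pd2 s H (\<zeta> w)) = \<nu> / \<Omega> * DH (0, pd i N y)"
    unfolding DH_def sum_pd2[OF Hd[OF w], symmetric] by (simp add: sum_distrib_left mult.assoc)
  moreover have "(\<Sum>s\<in>UNIV. pd1 s H (\<zeta> w) * (pd i x y $ s / \<Omega>)) = DH (pd i x y, 0) / \<Omega>"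
    unfolding DH_def sum_pd1[OF Hd[OF w], symmetric] by (simp add: sum_divide_distrib)
  ultimately have "pfaff_rhs H (Omega l \<circ> \<Lambda>) x N i w
      = \<nu> * (- (\<nu> / \<Omega> * DH (0, pd i N y)) - DH (pd i x y, 0) / \<Omega>)"
    by (simp add: pfaff_rhs_def wy \<zeta>_def \<Omega>_def Let_def)
  \<comment> \<open>The extracted factor is the reciprocal of the \<nu>-derivative of
    \<open>H \<circ> \<zeta>\<close>; the bracket will turn out to be its derivative in the
    \<open>i\<close>-th coordinate of \<open>y\<close>.\<close>
  also have "\<dots> = - (\<nu> / \<Omega> * (DH (pd i x y, 0) + \<nu> *\<^sub>R DH (0, pd i N y)))"
    using W[OF w] by (simp add: field_simps flip: \<Omega>_def)
  also have "DH (pd i x y, 0) + \<nu> *\<^sub>R DH (0, pd i N y) = DH (pd i x y, \<nu> *\<^sub>R pd i N y)"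
    unfolding linear_scale[OF DHlin, symmetric] linear_add[OF DHlin, symmetric] by simp
  also have "\<dots> = frechet_derivative (H \<circ> \<zeta>) (at w) (axis i 1, 0)"
    unfolding h[OF w] DH_def by (simp add: pd_def wy)
  finally have "pfaff_rhs H (Omega l \<circ> \<Lambda>) x N i w
      = - (\<nu> / \<Omega> * frechet_derivative (H \<circ> \<zeta>) (at w) (axis i 1, 0))" .
  then show "pfaff_rhs H (Omega l \<circ> \<Lambda>) x N i w =
      - (frechet_derivative (H \<circ> \<zeta>) (at w) (axis i 1, 0) / frechet_derivative (H \<circ> \<zeta>) (at w) (0, 1))"
    unfolding hnu[OF w] \<Omega>_def[symmetric] by (simp add: wy)
qed

section \<open>Coordinate changes and cotangent vectors\<close>

lemma is_chart_inj_on: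
  assumes "is_chart M c"
  shows "inj_on (coord c) (dom_of c)"
proof -
  have "dom_of c \<subseteq> topspace M"
    using assms by (simp add: is_chart_def openin_subset)
  then have "topspace (subtopology M (dom_of c)) = dom_of c"
    by (rule topspace_subtopology_subset)
  then show ?thesis
    using assms homeomorphic_imp_injective_map unfolding is_chart_def by metis
qed

lemma is_chart_open_image:
  assumes c: "is_chart M c" and V: "openin M V" "V \<subseteq> dom_of c"
  shows "open (coord c ` V)"
proof -
  have "openin (subtopology M (dom_of c)) V"
    using V by (auto simp: openin_subtopology)
  then have "openin (top_of_set (range_of c)) (coord c ` V)"
    using c homeomorphic_imp_open_map unfolding is_chart_def open_map_def by blast
  then show ?thesis
    using c openin_open_eq unfolding is_chart_def by blast
qed

lemma transition_coord:
  assumes "is_chart M c" "q \<in> dom_of c"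
  shows "transition c d (coord c q) = coord d q"
  using inv_into_f_f[OF is_chart_inj_on[OF assms(1)] assms(2)] by (simp add: transition_def)

lemma transition_differentiable:
  assumes "smooth_manifold M A" "c \<in> A" "d \<in> A" "q \<in> dom_of c" "q \<in> dom_of d"
  shows "transition c d differentiable at (coord c q)"
proof -
  have "smooth_on (coord c ` (dom_of c \<inter> dom_of d)) (transition c d)"
    using assms unfolding smooth_manifold_def compatible_charts_def by blast
  then show ?thesis
    using assms(4,5)
    by (intro twice_differentiable_onD(1)[OF smooth_on_imp_twice_differentiable_on]) auto
qed

text \<open>Passing from \<open>c\<close> to \<open>b\<close> directly or through \<open>d\<close>
  gives the same map near the point, and the chain rule does the rest. This makes the covectors
  constructed below obey the transformation law.\<close>

lemma frechet_derivative_transition_cocycle: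
  assumes M: "smooth_manifold M A" and A: "b \<in> A" "c \<in> A" "d \<in> A"
    and q: "q \<in> dom_of b" "q \<in> dom_of c" "q \<in> dom_of d"
  shows "frechet_derivative (transition d b) (at (coord d q)) (frechet_derivative (transition c d) (at (coord c q)) u)
    = frechet_derivative (transition c b) (at (coord c q)) u"
proof -
  have ch: "is_chart M b" "is_chart M c" "is_chart M d"
    using M A by (auto simp: smooth_manifold_def)
  \<comment> \<open>This overlap may leave the domain of \<open>b\<close>: both ways of passing to
    \<open>b\<close> evaluate \<open>coord b\<close> at the same point of the manifold, whatever its
    value there.\<close>
  let ?V = "dom_of c \<inter> dom_of d"
  have "openin M ?V"
    using ch by (auto simp: is_chart_def)
  then have open_V: "open (coord c ` ?V)"
    by (intro is_chart_open_image[OF ch(2)]) auto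
  have td: "transition d b differentiable at (transition c d (coord c q))"
    using transition_differentiable[OF M A(3) A(1) q(3) q(1)] by (simp add: transition_coord[OF ch(2) q(2)])
  have "frechet_derivative (transition c b) (at (coord c q))
      = frechet_derivative (transition d b \<circ> transition c d) (at (coord c q))"
  proof (rule frechet_derivative_transform_within_open[OF _ open_V])
    show "transition c b differentiable at (coord c q)"
      by (rule transition_differentiable[OF M A(2) A(1) q(2) q(1)])
    show "coord c q \<in> coord c ` ?V" using q by blast
    fix w assume "w \<in> coord c ` ?V"
    then show "transition c b w = (transition d b \<circ> transition c d) w"
      by (auto simp: transition_coord[OF ch(2)] transition_coord[OF ch(3)])
  qed
  also have "\<dots> = frechet_derivative (transition d b) (at (coord d q)) \<circ> frechet_derivative (transition c d) (at (coord c q))"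
    using frechet_derivative_compose[OF transition_differentiable[OF M A(2) A(3) q(2) q(3)] td]
    by (simp add: transition_coord[OF ch(2) q(2)])
  finally show ?thesis by simp
qed

lemma frechet_derivative_transition_self:
  assumes M: "smooth_manifold M A" and c: "c \<in> A" and q: "q \<in> dom_of c"
  shows "frechet_derivative (transition c c) (at (coord c q)) = (\<lambda>u. u)"
proof -
  have ch: "is_chart M c"
    using M c by (auto simp: smooth_manifold_def)
  have "frechet_derivative (transition c c) (at (coord c q)) = frechet_derivative (\<lambda>w. w) (at (coord c q))"
  proof (rule frechet_derivative_transform_within_open)
    show "transition c c differentiable at (coord c q)"
      by (rule transition_differentiable[OF M c c q q])
    show "open (range_of c)" using ch by (simp add: is_chart_def)
  qed (use q in \<open>auto simp: transition_coord[OF ch]\<close>)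
  then show ?thesis by simp
qed

text \<open>The components prescribed in \<open>c\<close> are carried to every other chart at
  \<open>q\<close> by the adjoint of the Jacobian of the change to \<open>c\<close>. The cocycle
  rule gives the transformation law, and the identity Jacobian in \<open>c\<close> itself returns
  \<open>p\<close>.\<close>

lemma cotangent_vector_with_components:
  assumes M: "smooth_manifold M A" and c: "c \<in> A" and q: "q \<in> dom_of c"
  obtains \<xi> where "\<xi> \<in> cotangent_space A q" "\<xi> c = p"
proof
  define J where "J d = frechet_derivative (transition d c) (at (coord d q))" for d
  define \<xi> where "\<xi> d = (if d \<in> charts_at A q then adjoint (J d) p else 0)" for d
  have pair: "\<xi> d \<bullet> u = p \<bullet> J d u" if "d \<in> charts_at A q" for d u
  proof -
    have "linear (J d)"
      unfolding J_def using that c q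
      by (intro linear_frechet_derivative transition_differentiable[OF M]) (auto simp: charts_at_def)
    then show ?thesis
      using that adjoint_works[of "J d" u p] by (simp add: \<xi>_def inner_commute)
  qed
  have "\<xi> d \<bullet> frechet_derivative (transition b d) (at (coord b q)) u = \<xi> b \<bullet> u"
    if "b \<in> charts_at A q" "d \<in> charts_at A q" for b d u
    unfolding pair[OF that(1)] pair[OF that(2)] J_def
    using that c q by (subst frechet_derivative_transition_cocycle[OF M]) (auto simp: charts_at_def)
  then show "\<xi> \<in> cotangent_space A q"
    by (simp add: cotangent_space_def \<xi>_def)
  have "c \<in> charts_at A q" using c q by (simp add: charts_at_def)
  then have "\<xi> c \<bullet> u = p \<bullet> u" for u
    by (simp add: pair J_def frechet_derivative_transition_self[OF M c q])
  then show "\<xi> c = p"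
    by (metis vector_eq_ldot inner_commute)
qed

section \<open>The inverse Legendre map in a chart\<close>

text \<open>\<open>bundle_point\<close> is an \<open>inv_into\<close>, so it yields a genuine
  preimage only once \<open>z\<close> is known to be attained; the covector with components
  \<open>snd z\<close> at the base point attains it.\<close>

lemma bundle_point_cotangent:
  assumes M: "smooth_manifold M A" and c: "c \<in> A" and z: "z \<in> range_of c \<times> UNIV"
  defines "e \<equiv> bundle_point (cotangent_bundle M A) c z"
  shows "e \<in> cotangent_bundle M A" "fst e \<in> dom_of c" "bundle_coord c e = z"
proof -
  let ?E = "{e \<in> cotangent_bundle M A. fst e \<in> dom_of c}"
  obtain q where q: "q \<in> dom_of c" "fst z = coord c q"
    using z by auto
  obtain \<xi> where \<xi>: "\<xi> \<in> cotangent_space A q" "\<xi> c = snd z"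
    using cotangent_vector_with_components[OF M c q(1)] .
  have "q \<in> topspace M"
    using M c q(1) unfolding smooth_manifold_def by blast
  with q \<xi> have "(q, \<xi>) \<in> ?E" "z = bundle_coord c (q, \<xi>)"
    by (simp_all add: cotangent_bundle_def bundle_coord_def prod_eq_iff)
  then have im: "z \<in> bundle_coord c ` ?E" by blast
  show "e \<in> cotangent_bundle M A" "fst e \<in> dom_of c"
    using inv_into_into[OF im] by (auto simp: e_def bundle_point_def)
  show "bundle_coord c e = z"
    using f_inv_into_f[OF im] by (simp add: e_def bundle_point_def)
qed

text \<open>The Legendre map keeps base points, and its components in \<open>c\<close> are by
  definition the velocity derivatives of the Lagrange function. Reading both facts at a preimage of
  the covector gives the two properties of \<open>\<Lambda>\<close> assumed in the locale.\<close>

lemma legendre_inv_coord_props: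
  assumes M: "smooth_manifold M A" and L: "smoothly_invertible_legendre M A L"
    and c: "c \<in> A" and z: "z \<in> range_of c \<times> UNIV"
  shows "fst (legendre_inv_coord M A L c z) = fst z"
    and "pd2 i (lagr M A L c) (legendre_inv_coord M A L c z) = snd z $ i"
proof -
  define e where "e = bundle_point (cotangent_bundle M A) c z"
  define w where "w = legendre_inv M A L e"
  note e = bundle_point_cotangent[OF M c z, folded e_def]
  \<comment> \<open>The Legendre map is onto the cotangent bundle, so \<open>inv_into\<close>
    returns an actual preimage of \<open>e\<close>.\<close>
  have w: "legendre M A L w = e"
    using L e(1) unfolding w_def legendre_inv_def smoothly_invertible_legendre_def
    by (intro f_inv_into_f) (simp add: bij_betw_def)
  have fst_w: "fst w = fst e"
    using arg_cong[OF w, of fst] by (simp add: legendre_def)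
  have coord: "legendre_inv_coord M A L c z = bundle_coord c w"
    by (simp add: legendre_inv_coord_def w_def e_def)
  show "fst (legendre_inv_coord M A L c z) = fst z"
    using arg_cong[OF e(3), of fst] by (simp add: coord bundle_coord_def fst_w)
  have "c \<in> charts_at A (fst w)"
    using c e(2) by (simp add: charts_at_def fst_w)
  then have "snd e c = (\<chi> i. pd2 i (lagr M A L c) (bundle_coord c w))"
    by (subst w[symmetric]) (simp add: legendre_def)
  then show "pd2 i (lagr M A L c) (legendre_inv_coord M A L c z) = snd z $ i"
    using arg_cong[OF e(3), of snd] by (simp add: coord bundle_coord_def vec_eq_iff)
qed

theorem theorem8p1:
  fixes M :: "'m topology"
    and A :: "('m, 'n::finite) chart set"
    and L :: "'m \<times> ('m, 'n) components \<Rightarrow> real"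
  assumes dim: "CARD('n) \<ge> 2" "CARD('k::finite) = CARD('n) - 1"
    and M: "smooth_manifold M A"
    and L: "smooth_on_TM M A L"
    and legendre: "smoothly_invertible_legendre M A L"
    and mu_pos: "\<forall>c\<in>A. \<forall>x\<in>range_of c. \<forall>v. positive_definite (mu (lagr M A L c) (x, v))"
    and Omega_pos: "\<forall>c\<in>A. \<forall>x\<in>range_of c. \<forall>v. v \<noteq> 0 \<longrightarrow> Omega (lagr M A L c) (x, v) > 0"
  shows "\<forall>\<sigma>. \<forall>c\<in>A. \<forall>(Y :: (real^'k) set) g N.
           smooth_hypersurface M A \<sigma> \<longrightarrow>
           local_coordinates M \<sigma> c Y g \<longrightarrow>
           normal_covector_field Y (coord c \<circ> g) N \<longrightarrow>
           pfaff_compatible Y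
             (pfaff_rhs (Hamiltonian M A L c) (Omega_dual M A L c) (coord c \<circ> g) N)"
proof (intro allI ballI impI)
  fix \<sigma> c g and Y :: "(real^'k) set" and N
  assume c: "c \<in> A" and g: "local_coordinates M \<sigma> c Y g"
    and N: "normal_covector_field Y (coord c \<circ> g) N"
  \<comment> \<open>The image of \<open>g\<close> lies in the domain of \<open>c\<close>, so the
    whole question is settled in this one chart, whose coordinate expressions form an instance of
    the locale.\<close>
  interpret legendre_transform "range_of c" "lagr M A L c" "legendre_inv_coord M A L c"
  proof
    show "open (range_of c)"
      using M c by (auto simp: smooth_manifold_def is_chart_def)
    show "twice_differentiable_on (range_of c \<times> UNIV) (lagr M A L c)"
      using L c by (auto simp: smooth_on_TM_def intro: smooth_on_imp_twice_differentiable_on)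
    fix z :: "(real^'n) \<times> (real^'n)" assume z: "z \<in> range_of c \<times> UNIV"
    show "legendre_inv_coord M A L c differentiable at z"
      using legendre c unfolding smoothly_invertible_legendre_def
      by (intro twice_differentiable_onD(1)[OF smooth_on_imp_twice_differentiable_on z]) blast
    show "fst (legendre_inv_coord M A L c z) = fst z"
      "pd2 i (lagr M A L c) (legendre_inv_coord M A L c z) = snd z $ i" for i
      using legendre_inv_coord_props[OF M legendre c z] by auto
  qed
  have "pfaff_compatible Y (pfaff_rhs H (Omega (lagr M A L c) \<circ> legendre_inv_coord M A L c) (coord c \<circ> g) N)"
  proof (rule pfaff_compatible_rhs)
    show "Omega (lagr M A L c) (x, v) > 0" if "x \<in> range_of c" "v \<noteq> 0" for x v
      using Omega_pos c that by blast
    show "open Y" "twice_differentiable_on Y (coord c \<circ> g)" "(coord c \<circ> g) ` Y \<subseteq> range_of c"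
      using g by (auto simp: local_coordinates_def intro: smooth_on_imp_twice_differentiable_on)
    show "twice_differentiable_on Y N" "\<And>y. y \<in> Y \<Longrightarrow> N y \<noteq> 0"
      using N by (auto simp: normal_covector_field_def intro: smooth_on_imp_twice_differentiable_on)
  qed
  moreover have "H = Hamiltonian M A L c"
    by (simp add: fun_eq_iff H_def Hamiltonian_def)
  ultimately show "pfaff_compatible Y
      (pfaff_rhs (Hamiltonian M A L c) (Omega_dual M A L c) (coord c \<circ> g) N)"
    by (simp add: Omega_dual_def)
qed

end
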